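(* Let $1\le p<q<\infty$, let $(X,\mu)$ be a $\sigma$-finite standard measure space, let $G$ be a topological group and let $G\to\mathrm{Aut}(X,[\mu])\ltimes L_0(X,\mu,\mathbf{T})$, $g\mapsto(\sigma_g,\omega_g)$, be a continuous homomorphism. Suppose that $H^1_\sharp(G,\pi^{q,\mu},L_q(X,\mu))=0$, i.e. for every $f\in L_0(X,\mu)$ such that $\pi^{q,\mu}(g)f-f\in L_q(X,\mu)$ for all $g\in G$, there exists $h\in L_q(X,\mu)$ with $\pi^{q,\mu}(g)f-f=\pi^{q,\mu}(g)h-h$ for all $g$. Then $H^1_\sharp(G,\pi^{p,\mu},L_p(X,\mu))=0$, i.e. the same statement holds with $q$ replaced by $p$.
   Context: $\mathrm{Aut}(X,[\mu])$ is the group of nonsingular automorphisms of $(X,\mu)$ (modulo null sets), with the topology of pointwise convergence on probability measures in $[\mu]$; it acts on $L_0(X,\mu,\mathbf{T})$ by $\theta(u)=u\circ\theta^{-1}$, and the semidirect product has multiplication $(\theta,u)(\theta',u')=(\theta\theta',u\,\theta(u'))$. For $0<r<\infty$, the element $(\theta,u)$ acts on $L_0(X,\mu)$ by $\pi^{r,\mu}(\theta,u)f=u\cdot\big(\tfrac{d\theta_*\mu}{d\mu}\big)^{1/r}\,f\circ\theta^{-1}$, which restricts to a linear isometry of $L_r(X,\mu)$; composing with the homomorphism from $G$ gives $\pi^{r,\mu}:G\to$ linear maps of $L_0(X,\mu)$. $H^1(G,\pi^{r,\mu},L_r)$ is the space of continuous cocycles $c:G\to L_r$ with $c(gh)=c(g)+\pi^{r,\mu}(g)c(h)$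 modulo those of the form $g\mapsto\pi^{r,\mu}(g)f-f$ with $f\in L_r$, and $H^1_\sharp(G,\pi^{r,\mu},L_r)$ is the kernel of the natural map $H^1(G,\pi^{r,\mu},L_r(X,\mu))\to H^1(G,\pi^{r,\mu},L_0(X,\mu))$. *)

theory Defs
  imports "HOL-Probability.Probability"
begin

definition borel_iso_onto :: "'a measure \<Rightarrow> ('a \<Rightarrow> 'p::polish_space) \<Rightarrow> 'p set \<Rightarrow> bool" where
  "borel_iso_onto M f B \<longleftrightarrow> B \<in> sets borel \<and> bij_betw f (space M) B \<and>
     f \<in> measurable M borel \<and> (\<forall>A\<in>sets M. f ` A \<in> sets borel)"

definition nonsing_aut :: "'a measure \<Rightarrow> ('a \<Rightarrow> 'a) \<Rightarrow> bool" where
  "nonsing_aut M \<theta> \<longleftrightarrow> bij_betw \<theta> (space M) (space M) \<and> \<theta> \<in> measurable M M \<and>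
     inv_into (space M) \<theta> \<in> measurable M M \<and>
     (\<forall>A\<in>sets M. emeasure M (\<theta> -` A \<inter> space M) = 0 \<longleftrightarrow> emeasure M A = 0)"

definition equiv_prob :: "'a measure \<Rightarrow> 'a measure \<Rightarrow> bool" where
  "equiv_prob M \<nu> \<longleftrightarrow> prob_space \<nu> \<and> sets \<nu> = sets M \<and>
     (\<forall>A\<in>sets M. emeasure \<nu> A = 0 \<longleftrightarrow> emeasure M A = 0)"

text \<open>Continuity of g \<mapsto> sigma_g into Aut(X,[mu]): for every probability measure nu in [mu],
  g \<mapsto> (sigma_g)_* nu is continuous for the total variation norm.\<close>
definition aut_continuous :: "'a measure \<Rightarrow> ('g::topological_space \<Rightarrow> 'a \<Rightarrow> 'a) \<Rightarrow> bool" where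
  "aut_continuous M \<sigma> \<longleftrightarrow> (\<forall>\<nu>. equiv_prob M \<nu> \<longrightarrow> (\<forall>g0. \<forall>e>0. \<forall>\<^sub>F g in nhds g0.
     \<forall>A\<in>sets M. \<bar>measure (distr \<nu> M (\<sigma> g)) A - measure (distr \<nu> M (\<sigma> g0)) A\<bar> < e))"

definition L0_continuous :: "'a measure \<Rightarrow> ('g::topological_space \<Rightarrow> 'a \<Rightarrow> complex) \<Rightarrow> bool" where
  "L0_continuous M \<omega> \<longleftrightarrow> (\<forall>g0. \<forall>A\<in>sets M. emeasure M A < \<infinity> \<longrightarrow> (\<forall>e>0. \<forall>\<^sub>F g in nhds g0.
     emeasure M {x\<in>A. e \<le> norm (\<omega> g x - \<omega> g0 x)} < ennreal e))"

definition memLp :: "'a measure \<Rightarrow> real \<Rightarrow> ('a \<Rightarrow> complex) \<Rightarrow> bool" where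
  "memLp M r h \<longleftrightarrow> h \<in> borel_measurable M \<and> integrable M (\<lambda>x. norm (h x) powr r)"

definition pi_op :: "'a measure \<Rightarrow> real \<Rightarrow> ('a \<Rightarrow> 'a) \<Rightarrow> ('a \<Rightarrow> complex) \<Rightarrow> ('a \<Rightarrow> complex) \<Rightarrow> 'a \<Rightarrow> complex" where
  "pi_op M r \<theta> u f = (\<lambda>x. u x * of_real (enn2real (RN_deriv M (distr M M \<theta>) x) powr (1 / r))
       * f (inv_into (space M) \<theta> x))"

definition H1_sharp_vanishes :: "'a measure \<Rightarrow> real \<Rightarrow> ('g \<Rightarrow> 'a \<Rightarrow> 'a) \<Rightarrow> ('g \<Rightarrow> 'a \<Rightarrow> complex) \<Rightarrow> bool" where
  "H1_sharp_vanishes M r \<sigma> \<omega> \<longleftrightarrow>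
    (\<forall>f \<in> borel_measurable M.
       (\<forall>g. memLp M r (\<lambda>x. pi_op M r (\<sigma> g) (\<omega> g) f x - f x)) \<longrightarrow>
       (\<exists>h. memLp M r h \<and> (\<forall>g. AE x in M.
           pi_op M r (\<sigma> g) (\<omega> g) f x - f x = pi_op M r (\<sigma> g) (\<omega> g) h x - h x)))"

end

theory Submission
  imports Defs
begin

text \<open>
  The Mazur map \<open>m\<^sub>s(z) = |z|\<^sup>s sgn z\<close> with \<open>s = p/q\<close> intertwines \<open>\<pi>\<^sup>p\<close> and \<open>\<pi>\<^sup>q\<close>, and it is
  \<open>s\<close>-Hoelder. Hence, if the coboundary of \<open>f\<close> lies in \<open>L\<^sub>p\<close>, that of \<open>m\<^sub>s f\<close> lies in \<open>L\<^sub>q\<close>, and the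
  hypothesis writes \<open>m\<^sub>s f = K + H\<close> with \<open>K\<close> invariant and \<open>H \<in> L\<^sub>q\<close>. The inverse map is only
  controlled by \<open>|m(a) - m(b)|\<^sup>p \<le> \<eta> |a|\<^sup>q + C |a - b|\<^sup>q\<close>, with \<open>C\<close> depending on \<open>\<eta>\<close>, so the splitting
  is applied three times.

  Apply it to \<open>f\<close>, and then to \<open>f\<^sub>1 = f - m\<^sub>1\<^sub>/\<^sub>s K\<close>, which gives \<open>K\<^sub>1\<close>. The ratio \<open>|K| / |K\<^sub>1|\<close> is
  invariant, and \<open>f\<^sub>1\<close> is \<open>p\<close>-integrable on each set where the ratio is bounded or \<open>K\<^sub>1 = 0\<close>. This
  partitions the space into countably many invariant pieces. On the \<open>n\<close>-th piece subtract an invariant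
  function whose \<open>L\<^sub>p\<close>-distance to \<open>f\<^sub>1\<close> is optimal up to \<open>2\<^sup>-\<^sup>n\<close>, and split the difference \<open>h\<close> once more
  as \<open>m\<^sub>s h = K\<^sub>2 + H\<^sub>2\<close>. By near-optimality, subtracting \<open>m\<^sub>1\<^sub>/\<^sub>s K\<^sub>2\<close> cannot improve the distance much,
  while the inequality with \<open>\<eta> = 1/2\<close> says that it halves it up to \<open>\<integral>|H\<^sub>2|\<^sup>q\<close>. Thus \<open>\<integral>|h|\<^sup>p\<close> over the
  pieces is summable.
\<close>

section \<open>The Mazur map and its two continuity estimates\<close>

definition mazur :: "real \<Rightarrow> complex \<Rightarrow> complex" where
  "mazur s z = of_real (norm z powr s) * sgn z"

lemma norm_mazur [simp]: "norm (mazur s z) = norm z powr s"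
  by (cases "z = 0") (simp_all add: mazur_def norm_mult norm_sgn)

lemma mazur_0 [simp]: "mazur s 0 = 0"
  by (simp add: mazur_def)

lemma mazur_1 [simp]: "mazur s 1 = 1"
  by (simp add: mazur_def)

lemma mazur_mult: "mazur s (a * b) = mazur s a * mazur s b"
  by (simp add: mazur_def norm_mult powr_mult sgn_mult)

lemma mazur_of_real: "0 \<le> d \<Longrightarrow> mazur s (of_real d) = of_real (d powr s)"
  by (cases "d = 0") (simp_all add: mazur_def sgn_of_real)

lemma mazur_unit: "norm u = 1 \<Longrightarrow> mazur s u = u"
  by (simp add: mazur_def sgn_eq)

lemma mazur_mazur: "mazur s (mazur t z) = mazur (t * s) z"
proof (cases "z = 0")
  case False
  then have "mazur s (sgn z) = sgn z"
    by (intro mazur_unit) (simp add: norm_sgn)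
  then show ?thesis
    by (simp add: mazur_def [of t] mazur_mult mazur_of_real powr_powr)
      (simp add: mazur_def)
qed simp

lemma mazur_exponent_1 [simp]: "mazur 1 z = z"
  by (cases "z = 0") (simp_all add: mazur_def sgn_eq)

lemma measurable_mazur [measurable]: "mazur s \<in> borel_measurable borel"
  unfolding mazur_def [abs_def] sgn_eq by measurable

lemma isCont_mazur_1: "isCont (mazur s) 1"
  unfolding mazur_def [abs_def]
  by (intro continuous_intros) auto

text \<open>Far from 1 the left side is at most 2. Near 1, \<open>norm w\<close> exceeds 1/2, and
  there the modulus and the sign are compared with 1 linearly; the constants 1 and 4 add up to 5,
  and the exponent \<open>s\<close> comes from t \<le> \<open>t powr s\<close> on [0,1].\<close>

lemma mazur_holder_at_1:
  assumes s: "0 < s" "s \<le> 1" and w: "norm w \<le> 1"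
  shows "norm (1 - mazur s w) \<le> 5 * norm (1 - w) powr s"
proof (cases "norm (1 - w) \<ge> 1 / 2")
  case True
  have "norm (1 - mazur s w) \<le> 1 + norm w powr s"
    using norm_triangle_ineq4 [of 1 "mazur s w"] by simp
  also have "\<dots> \<le> 1 + 1"
    using s w by (intro add_mono powr_le1) auto
  also have "\<dots> \<le> 4 * (1 / 2) powr s"
    using powr_mono' [of s 1 "1 / 2"] s by simp
  also have "\<dots> \<le> 5 * norm (1 - w) powr s"
    using s True powr_mono2 [of s "1 / 2" "norm (1 - w)"] by (intro mult_mono) auto
  finally show ?thesis .
next
  case False
  then have nw: "1 / 2 < norm w"
    using norm_triangle_ineq2 [of 1 w] by simp
  then have w0: "w \<noteq> 0" by auto
  \<comment> \<open>Both \<open>norm w\<close> and \<open>w\<close> lie within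
    \<open>norm (1 - w)\<close> of 1, which controls the angular part.\<close>
  have "of_real (norm w) * (1 - sgn w) = of_real (norm w) - w"
    using w0 by (simp add: sgn_eq right_diff_distrib)
  then have "norm w * norm (1 - sgn w) = norm (of_real (norm w) - w)"
    using norm_mult [of "of_real (norm w)" "1 - sgn w"] by simp
  also have "\<dots> \<le> norm (of_real (norm w) - 1 :: complex) + norm (1 - w)"
    using norm_triangle_ineq [of "of_real (norm w) - 1 :: complex" "1 - w"] by simp
  also have "norm (of_real (norm w) - 1 :: complex) = \<bar>norm w - 1\<bar>"
    by (metis norm_of_real of_real_1 of_real_diff)
  also have "\<dots> \<le> norm (1 - w)"
    using norm_triangle_ineq3 [of w 1] by (simp add: norm_minus_commute)
  finally have "norm w * norm (1 - sgn w) \<le> 2 * norm (1 - w)" by simp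
  moreover have "(1 / 2) * norm (1 - sgn w) \<le> norm w * norm (1 - sgn w)"
    using nw by (intro mult_right_mono) auto
  ultimately have sgn: "norm (1 - sgn w) \<le> 4 * norm (1 - w)" by simp
  have ws: "norm w powr s \<le> 1" "norm w \<le> norm w powr s"
    using s w nw powr_mono' [of s 1 "norm w"] by (auto intro: powr_le1)
  \<comment> \<open>Radial part plus angular part.\<close>
  have "1 - mazur s w = of_real (1 - norm w powr s) + of_real (norm w powr s) * (1 - sgn w)"
    by (simp add: mazur_def algebra_simps)
  then have "norm (1 - mazur s w) \<le> (1 - norm w powr s) + norm w powr s * norm (1 - sgn w)"
    using ws norm_triangle_ineq [of "of_real (1 - norm w powr s)" "of_real (norm w powr s) * (1 - sgn w)"]
    by (simp add: norm_mult del: of_real_diff)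
  also have "\<dots> \<le> (1 - norm w) + 1 * norm (1 - sgn w)"
    using ws by (intro add_mono mult_right_mono) auto
  also have "\<dots> \<le> 5 * norm (1 - w)"
    using sgn norm_triangle_ineq2 [of 1 w] by simp
  also have "\<dots> \<le> 5 * norm (1 - w) powr s"
    using s False powr_mono' [of s 1 "norm (1 - w)"] by simp
  finally show ?thesis .
qed

text \<open>By homogeneity the entry of larger modulus can be factored out; the quotient lies in the
  unit disc.\<close>

lemma mazur_holder:
  assumes s: "0 < s" "s \<le> 1"
  shows "norm (mazur s a - mazur s b) \<le> 5 * norm (a - b) powr s"
proof -
  have *: "norm (mazur s a - mazur s b) \<le> 5 * norm (a - b) powr s" if "norm b \<le> norm a" for a b
  proof (cases "a = 0")
    case False
    define w where "w = b / a"
    have b: "b = a * w" and w: "norm w \<le> 1"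
      using False that by (simp_all add: w_def norm_divide)
    have "norm (mazur s a - mazur s b) = norm a powr s * norm (1 - mazur s w)"
      by (simp add: b mazur_mult norm_mult [symmetric] right_diff_distrib flip: norm_mazur)
    also have "\<dots> \<le> norm a powr s * (5 * norm (1 - w) powr s)"
      using mazur_holder_at_1 [OF s w] by (intro mult_left_mono) auto
    also have "\<dots> = 5 * norm (a - b) powr s"
      by (simp add: b powr_mult [symmetric] norm_mult [symmetric] right_diff_distrib)
    finally show ?thesis .
  qed (use that in simp)
  show ?thesis
    using * [of a b] * [of b a] by (cases "norm b \<le> norm a") (simp_all add: norm_minus_commute)
qed

text \<open>Continuity at 1 and homogeneity suffice: a small relative error gives the \<eta> term;
  otherwise both norms are at most a multiple of \<open>norm (a - b)\<close>, which gives the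
  \<open>C\<close> term.\<close>

lemma mazur_expand:
  assumes p: "0 < p" and q: "0 < q" and \<eta>: "0 < \<eta>"
  obtains C where "0 \<le> C"
    "\<And>a b. norm (mazur (q / p) a - mazur (q / p) b) powr p \<le> \<eta> * norm a powr q + C * norm (a - b) powr q"
proof -
  define s where "s = q / p"
  have s: "0 < s" "s * p = q" using p q by (auto simp: s_def)
  \<comment> \<open>The p-th power of this tolerance is \<eta>.\<close>
  obtain d where d: "0 < d" "\<And>w. norm (w - 1) < d \<Longrightarrow> norm (mazur s w - 1) < \<eta> powr (1 / p)"
    using isCont_mazur_1 [of s] \<eta> unfolding continuous_at_eps_delta dist_norm mazur_1
    by (metis powr_gt_zero less_irrefl)
  \<comment> \<open>The summands come from the bounds \<open>1 / d\<close> and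
    \<open>1 + 1 / d\<close> for \<open>norm a\<close> and \<open>norm b\<close> relative to
    \<open>norm (a - b)\<close> in the far case.\<close>
  define c where "c = (1 / d) powr s + (1 + 1 / d) powr s"
  have c: "0 \<le> c" by (simp add: c_def)
  have "norm (mazur s a - mazur s b) powr p \<le> \<eta> * norm a powr q + c powr p * norm (a - b) powr q" for a b
  proof (cases "norm (a - b) < d * norm a")
    case True
    then have a: "a \<noteq> 0" by auto
    define w where "w = b / a"
    have b: "b = a * w" using a by (simp add: w_def)
    have "norm a * norm (w - 1) < norm a * d"
      using True by (simp add: b norm_mult [symmetric] right_diff_distrib norm_minus_commute mult.commute)
    then have "norm (w - 1) < d" using a by simp
    then have "norm (1 - mazur s w) powr p \<le> (\<eta> powr (1 / p)) powr p"
      using d(2) [of w] p by (intro powr_mono2) (auto simp: norm_minus_commute)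
    then have le: "norm (1 - mazur s w) powr p \<le> \<eta>"
      using p \<eta> by (simp add: powr_powr)
    have "norm (mazur s a - mazur s b) = norm a powr s * norm (1 - mazur s w)"
      by (simp add: b mazur_mult norm_mult [symmetric] right_diff_distrib flip: norm_mazur)
    then have "norm (mazur s a - mazur s b) powr p = norm a powr q * norm (1 - mazur s w) powr p"
      by (simp add: powr_mult powr_powr s)
    also have "\<dots> \<le> norm a powr q * \<eta>"
      using le by (intro mult_left_mono) auto
    finally show ?thesis
      by (simp add: mult.commute add_increasing2)
  next
    case False
    then have a: "norm a \<le> (1 / d) * norm (a - b)"
      using d by (simp add: field_simps)
    then have b: "norm b \<le> (1 + 1 / d) * norm (a - b)"
      using norm_triangle_sub [of b a] by (simp add: norm_minus_commute algebra_simps)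
    have "norm (mazur s a - mazur s b) \<le> norm a powr s + norm b powr s"
      using norm_triangle_ineq4 [of "mazur s a" "mazur s b"] by simp
    also have "\<dots> \<le> ((1 / d) * norm (a - b)) powr s + ((1 + 1 / d) * norm (a - b)) powr s"
      using a b s by (intro add_mono powr_mono2) auto
    also have "\<dots> = c * norm (a - b) powr s"
      by (simp only: c_def powr_mult distrib_right [of "_ powr _"])
    finally have "norm (mazur s a - mazur s b) powr p \<le> (c * norm (a - b) powr s) powr p"
      using p by (intro powr_mono2) auto
    also have "\<dots> = c powr p * norm (a - b) powr q"
      using c by (simp add: powr_mult powr_powr s)
    finally show ?thesis
      using \<eta> by (simp add: add_increasing)
  qed
  then show thesis
    using that [of "c powr p"] by (simp add: s_def)
qed

section \<open>Powers of norms and membership in L_r\<close>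

lemma norm_add_powr_le:
  fixes a b :: complex
  assumes "0 < q"
  shows "norm (a + b) powr q \<le> 2 powr q * (norm a powr q + norm b powr q)"
proof -
  have "norm (a + b) powr q \<le> (2 * max (norm a) (norm b)) powr q"
    using assms norm_triangle_ineq [of a b] by (intro powr_mono2) auto
  also have "\<dots> = 2 powr q * max (norm a) (norm b) powr q"
    by (simp add: powr_mult)
  also have "\<dots> \<le> 2 powr q * (norm a powr q + norm b powr q)"
    by (intro mult_left_mono) (auto simp: max_def)
  finally show ?thesis .
qed

lemma memLp_iff_nn_integral:
  "memLp M r h \<longleftrightarrow> h \<in> borel_measurable M \<and> (\<integral>\<^sup>+x. ennreal (norm (h x) powr r) \<partial>M) < \<infinity>"
  unfolding memLp_def by (auto simp: integrable_iff_bounded)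

section \<open>Invariant functions, coboundaries and the splitting of cocycles\<close>

definition pi_invariant ::
  "'a measure \<Rightarrow> real \<Rightarrow> ('g \<Rightarrow> 'a \<Rightarrow> 'a) \<Rightarrow> ('g \<Rightarrow> 'a \<Rightarrow> complex) \<Rightarrow> ('a \<Rightarrow> complex) \<Rightarrow> bool" where
  "pi_invariant M r \<sigma> \<omega> v \<longleftrightarrow> v \<in> borel_measurable M \<and>
     (\<forall>g. AE x in M. pi_op M r (\<sigma> g) (\<omega> g) v x = v x)"

lemma pi_op_diff:
  "pi_op M r \<theta> u (\<lambda>x. f x - h x) x = pi_op M r \<theta> u f x - pi_op M r \<theta> u h x"
  by (simp add: pi_op_def algebra_simps)

lemma pi_op_add:
  "pi_op M r \<theta> u (\<lambda>x. f x + h x) x = pi_op M r \<theta> u f x + pi_op M r \<theta> u h x"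
  by (simp add: pi_op_def algebra_simps)

text \<open>The Mazur map is multiplicative, fixes unimodular numbers and turns the density power
  \<open>1 / r\<close> into \<open>1 / t\<close>.\<close>

lemma pi_op_mazur:
  assumes "norm (u x) = 1" "0 < r"
  shows "mazur (r / t) (pi_op M r \<theta> u f x) = pi_op M t \<theta> u (\<lambda>x. mazur (r / t) (f x)) x"
  using assms by (simp add: pi_op_def mazur_mult mazur_unit mazur_of_real powr_powr)

lemma borel_measurable_pi_op:
  assumes "nonsing_aut M \<theta>" and [measurable]: "u \<in> borel_measurable M" "f \<in> borel_measurable M"
  shows "pi_op M r \<theta> u f \<in> borel_measurable M"
proof -
  have [measurable]: "inv_into (space M) \<theta> \<in> measurable M M"
    using assms by (simp add: nonsing_aut_def)
  show ?thesis unfolding pi_op_def by measurable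
qed

lemma pi_invariant_0: "pi_invariant M r \<sigma> \<omega> (\<lambda>_. 0)"
  by (simp add: pi_invariant_def pi_op_def)

lemma pi_invariant_add:
  assumes "pi_invariant M r \<sigma> \<omega> v" "pi_invariant M r \<sigma> \<omega> w"
  shows "pi_invariant M r \<sigma> \<omega> (\<lambda>x. v x + w x)"
proof -
  have "AE x in M. pi_op M r (\<sigma> g) (\<omega> g) (\<lambda>x. v x + w x) x = v x + w x" for g
  proof -
    have "AE x in M. pi_op M r (\<sigma> g) (\<omega> g) v x = v x" "AE x in M. pi_op M r (\<sigma> g) (\<omega> g) w x = w x"
      using assms by (auto simp: pi_invariant_def)
    then show ?thesis by eventually_elim (simp add: pi_op_add)
  qed
  then show ?thesis using assms by (auto simp: pi_invariant_def)
qed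

lemma pi_invariant_AE_diff:
  assumes "pi_invariant M r \<sigma> \<omega> v"
  shows "AE x in M. pi_op M r (\<sigma> g) (\<omega> g) f x - f x =
           pi_op M r (\<sigma> g) (\<omega> g) (\<lambda>x. f x - v x) x - (f x - v x)"
proof -
  have "AE x in M. pi_op M r (\<sigma> g) (\<omega> g) v x = v x"
    using assms by (simp add: pi_invariant_def)
  then show ?thesis by eventually_elim (simp add: pi_op_diff)
qed

text \<open>An invariant \<open>v\<close> has zero coboundary almost everywhere. This is what makes
  repeated splitting possible.\<close>

lemma memLp_coboundary_diff_invariant:
  assumes v: "pi_invariant M r \<sigma> \<omega> v" and f: "f \<in> borel_measurable M"
    and aut: "nonsing_aut M (\<sigma> g)" and \<omega>: "\<omega> g \<in> borel_measurable M"
    and c: "memLp M r (\<lambda>x. pi_op M r (\<sigma> g) (\<omega> g) f x - f x)"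
  shows "memLp M r (\<lambda>x. pi_op M r (\<sigma> g) (\<omega> g) (\<lambda>x. f x - v x) x - (f x - v x))"
proof -
  have [measurable]: "f \<in> borel_measurable M" "v \<in> borel_measurable M"
    using f v by (auto simp: pi_invariant_def)
  have "(\<lambda>x. f x - v x) \<in> borel_measurable M" by measurable
  from borel_measurable_pi_op [OF aut \<omega> this]
  have "(\<lambda>x. pi_op M r (\<sigma> g) (\<omega> g) (\<lambda>x. f x - v x) x - (f x - v x)) \<in> borel_measurable M"
    by measurable
  moreover have "(\<integral>\<^sup>+x. ennreal (norm (pi_op M r (\<sigma> g) (\<omega> g) f x - f x) powr r) \<partial>M) =
      (\<integral>\<^sup>+x. ennreal (norm (pi_op M r (\<sigma> g) (\<omega> g) (\<lambda>x. f x - v x) x - (f x - v x)) powr r) \<partial>M)"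
    by (rule nn_integral_cong_AE) (use pi_invariant_AE_diff [OF v, of g f] in \<open>eventually_elim, simp only:\<close>)
  ultimately show ?thesis
    using c by (simp add: memLp_iff_nn_integral)
qed

lemma pi_invariant_mazur:
  assumes inv: "pi_invariant M r \<sigma> \<omega> v" and r: "0 < r"
    and \<omega>: "\<And>g. AE x in M. norm (\<omega> g x) = 1"
  shows "pi_invariant M t \<sigma> \<omega> (\<lambda>x. mazur (r / t) (v x))"
proof -
  have "AE x in M. pi_op M t (\<sigma> g) (\<omega> g) (\<lambda>x. mazur (r / t) (v x)) x = mazur (r / t) (v x)" for g
  proof -
    have "AE x in M. pi_op M r (\<sigma> g) (\<omega> g) v x = v x"
      using inv by (simp add: pi_invariant_def)
    with \<omega> [of g] show ?thesis
      by eventually_elim (simp add: r flip: pi_op_mazur)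
  qed
  moreover have [measurable]: "v \<in> borel_measurable M"
    using inv by (simp add: pi_invariant_def)
  ultimately show ?thesis by (simp add: pi_invariant_def)
qed

text \<open>Where the Radon-Nikodym derivative vanishes, every invariant function vanishes too, so the
  index only needs to be invariant off that set.\<close>

lemma pi_invariant_glue:
  fixes v :: "nat \<Rightarrow> 'a \<Rightarrow> complex"
  assumes inv: "\<And>n. pi_invariant M r \<sigma> \<omega> (v n)"
    and N [measurable]: "N \<in> measurable M (count_space UNIV)"
    and N_inv: "\<And>g. AE x in M. enn2real (RN_deriv M (distr M M (\<sigma> g)) x) = 0 \<or>
      N (inv_into (space M) (\<sigma> g) x) = N x"
  shows "pi_invariant M r \<sigma> \<omega> (\<lambda>x. v (N x) x)"
proof -
  have "AE x in M. pi_op M r (\<sigma> g) (\<omega> g) (\<lambda>x. v (N x) x) x = v (N x) x" for g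
  proof -
    have "AE x in M. \<forall>n. pi_op M r (\<sigma> g) (\<omega> g) (v n) x = v n x"
      using inv by (simp add: pi_invariant_def AE_all_countable)
    with N_inv [of g] show ?thesis
    proof eventually_elim
      case (elim x)
      then show ?case
        using elim(2) [rule_format, of "N x"] by (auto simp: pi_op_def)
    qed
  qed
  moreover have [measurable]: "v n \<in> borel_measurable M" for n
    using inv by (simp add: pi_invariant_def)
  ultimately show ?thesis by (simp add: pi_invariant_def)
qed

text \<open>Both norms are scaled by the same power of the density, which cancels when nonzero. The
  denominators then vanish together, so the value 0 of division by zero is respected.\<close>

lemma invariant_ratio:
  assumes K: "pi_invariant M r \<sigma> \<omega> K" and L: "pi_invariant M r \<sigma> \<omega> L"
    and \<omega>: "AE x in M. norm (\<omega> g x) = 1"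
  shows "AE x in M. enn2real (RN_deriv M (distr M M (\<sigma> g)) x) = 0 \<or>
    norm (K (inv_into (space M) (\<sigma> g) x)) / norm (L (inv_into (space M) (\<sigma> g) x)) = norm (K x) / norm (L x)"
proof -
  have "AE x in M. pi_op M r (\<sigma> g) (\<omega> g) K x = K x" "AE x in M. pi_op M r (\<sigma> g) (\<omega> g) L x = L x"
    using K L by (auto simp: pi_invariant_def)
  with \<omega> show ?thesis
  proof eventually_elim
    case (elim x)
    have "norm (K x) = norm (pi_op M r (\<sigma> g) (\<omega> g) K x)" "norm (L x) = norm (pi_op M r (\<sigma> g) (\<omega> g) L x)"
      using elim by simp_all
    then show ?case
      using elim(1) by (auto simp: pi_op_def norm_mult)
  qed
qed

text \<open>The Hoelder bound with exponent \<open>p / q\<close> dominates the q-th power of the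
  coboundary of \<open>F\<close> by \<open>5 powr q\<close> times the p-th power of that of
  \<open>f\<close>. Hence \<open>Hq\<close> applies to \<open>F\<close> and supplies
  \<open>H\<close>; \<open>K\<close> is the difference.\<close>

lemma mazur_cocycle_split:
  assumes pq: "0 < p" "p \<le> q"
    and aut: "\<And>g. nonsing_aut M (\<sigma> g)"
    and omega_meas: "\<And>g. \<omega> g \<in> borel_measurable M"
    and omega_T: "\<And>g. AE x in M. norm (\<omega> g x) = 1"
    and Hq: "H1_sharp_vanishes M q \<sigma> \<omega>"
    and f [measurable]: "f \<in> borel_measurable M"
    and fp: "\<And>g. memLp M p (\<lambda>x. pi_op M p (\<sigma> g) (\<omega> g) f x - f x)"
  obtains K H where "pi_invariant M q \<sigma> \<omega> K" "memLp M q H" "\<And>x. mazur (p / q) (f x) = K x + H x"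
proof -
  define F where "F = (\<lambda>x. mazur (p / q) (f x))"
  have F [measurable]: "F \<in> borel_measurable M" by (simp add: F_def)
  have s: "0 < p / q" "p / q \<le> 1" "p / q * q = p" using pq by auto
  have "memLp M q (\<lambda>x. pi_op M q (\<sigma> g) (\<omega> g) F x - F x)" for g
  proof -
    define c where "c = (\<lambda>x. pi_op M p (\<sigma> g) (\<omega> g) f x - f x)"
    have [measurable]: "pi_op M q (\<sigma> g) (\<omega> g) F \<in> borel_measurable M"
      using aut omega_meas by (intro borel_measurable_pi_op) auto
    have c: "c \<in> borel_measurable M" "(\<integral>\<^sup>+x. ennreal (norm (c x) powr p) \<partial>M) < \<infinity>"
      using fp [of g] by (auto simp: memLp_iff_nn_integral c_def)
    note [measurable] = c(1)
    have "(\<integral>\<^sup>+x. ennreal (norm (pi_op M q (\<sigma> g) (\<omega> g) F x - F x) powr q) \<partial>M)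
        \<le> (\<integral>\<^sup>+x. ennreal (5 powr q) * ennreal (norm (c x) powr p) \<partial>M)"
    proof (rule nn_integral_mono_AE)
      show "AE x in M. ennreal (norm (pi_op M q (\<sigma> g) (\<omega> g) F x - F x) powr q)
          \<le> ennreal (5 powr q) * ennreal (norm (c x) powr p)"
        using omega_T [of g]
      proof eventually_elim
        case (elim x)
        have "norm (pi_op M q (\<sigma> g) (\<omega> g) F x - F x) \<le> 5 * norm (c x) powr (p / q)"
          using mazur_holder [OF s(1,2), of "pi_op M p (\<sigma> g) (\<omega> g) f x" "f x"] elim pq
          by (simp add: pi_op_mazur c_def F_def)
        then have "norm (pi_op M q (\<sigma> g) (\<omega> g) F x - F x) powr q \<le> (5 * norm (c x) powr (p / q)) powr q"
          using pq by (intro powr_mono2) auto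
        also have "\<dots> = 5 powr q * norm (c x) powr p"
          using s pq by (simp add: powr_mult powr_powr)
        finally show ?case by (simp add: ennreal_mult [symmetric])
      qed
    qed
    also have "\<dots> < \<infinity>"
      using c(2) by (simp add: nn_integral_cmult ennreal_mult_less_top)
    finally show ?thesis by (simp add: memLp_iff_nn_integral)
  qed
  then obtain H where H: "memLp M q H" "\<And>g. AE x in M.
      pi_op M q (\<sigma> g) (\<omega> g) F x - F x = pi_op M q (\<sigma> g) (\<omega> g) H x - H x"
    using Hq F unfolding H1_sharp_vanishes_def by blast
  have "AE x in M. pi_op M q (\<sigma> g) (\<omega> g) (\<lambda>x. F x - H x) x = F x - H x" for g
    using H(2) [of g] by eventually_elim (simp add: pi_op_diff algebra_simps)
  then have "pi_invariant M q \<sigma> \<omega> (\<lambda>x. F x - H x)"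
    using H(1) by (auto simp: pi_invariant_def memLp_def)
  then show thesis
    by (rule that [OF _ H(1)]) (simp add: F_def)
qed

text \<open>Expanding around \<open>K\<close> costs \<eta> times \<open>norm K powr q\<close>. The
  ratio bound trades \<open>K\<close> for \<open>K1\<close>, and the second splitting trades
  \<open>K1\<close> for the remainder and \<open>H1\<close>; for small \<eta> the cost is
  absorbed.\<close>

lemma mazur_remainder_bound:
  assumes pq: "0 < p" "0 < q" and n: "0 \<le> n"
  obtains C where "0 \<le> C"
    "\<And>z K H K1 H1. \<lbrakk>mazur (p / q) z = K + H; mazur (p / q) (z - mazur (q / p) K) = K1 + H1;
        K1 = 0 \<or> norm K \<le> n * norm K1\<rbrakk>
      \<Longrightarrow> norm (z - mazur (q / p) K) powr p \<le> C * (norm H powr q + norm H1 powr q)"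
proof -
  define D where "D = n powr q * 2 powr q"
  \<comment> \<open>Chosen so that \<open>D * \<eta>\<close> is at most 1/2 and the \<open>K\<close>
    term can be moved to the left.\<close>
  define \<eta> where "\<eta> = 1 / (2 * D + 1)"
  have D: "0 \<le> D" by (simp add: D_def)
  have \<eta>: "0 < \<eta>" "\<eta> \<le> 1" "D * \<eta> \<le> 1 / 2" using D by (auto simp: \<eta>_def field_simps)
  obtain C where C: "0 \<le> C"
    "\<And>a b. norm (mazur (q / p) a - mazur (q / p) b) powr p \<le> \<eta> * norm a powr q + C * norm (a - b) powr q"
    using mazur_expand [OF pq \<eta>(1)] by blast
  \<comment> \<open>The final 1 serves the case \<open>K1 = 0\<close>, the rest the case of bounded
    ratio.\<close>
  define C' where "C' = 2 * D * (C + 1) + C + 1"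
  have bound: "norm (z - mazur (q / p) K) powr p \<le> C' * (norm H powr q + norm H1 powr q)"
    if z: "mazur (p / q) z = K + H" and z1: "mazur (p / q) (z - mazur (q / p) K) = K1 + H1"
      and or: "K1 = 0 \<or> norm K \<le> n * norm K1" for z K H K1 H1
  proof -
    define y where "y = z - mazur (q / p) K"
    have y: "norm y powr p = norm (K1 + H1) powr q"
      using pq by (simp add: y_def flip: z1) (simp add: powr_powr)
    have "mazur (q / p) (K + H) = z"
      \<comment> \<open>The two exponents are inverse, so \<open>y\<close> is the increment of
        \<open>mazur (q / p)\<close> from \<open>K\<close> to \<open>K + H\<close>.\<close>
      using pq by (simp add: mazur_mazur flip: z)
    then have yK: "norm y powr p \<le> \<eta> * norm K powr q + C * norm H powr q"
      using C(2) [of K "K + H"] by (simp add: y_def norm_minus_commute)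
    show ?thesis
    proof (cases "K1 = 0")
      case True
      have "norm y powr p = norm H1 powr q" using y True by simp
      also have "\<dots> \<le> 1 * (norm H powr q + norm H1 powr q)" by simp
      also have "\<dots> \<le> C' * (norm H powr q + norm H1 powr q)"
        using C D by (intro mult_right_mono) (auto simp: C'_def)
      finally show ?thesis by (simp add: y_def)
    next
      case False
      have "norm K powr q \<le> (n * norm K1) powr q"
        using or False pq by (intro powr_mono2) auto
      also have "\<dots> = n powr q * norm ((K1 + H1) + - H1) powr q"
        using n by (simp add: powr_mult)
      also have "\<dots> \<le> n powr q * (2 powr q * (norm y powr p + norm H1 powr q))"
        using norm_add_powr_le [OF pq(2), of "K1 + H1" "- H1"] y by (intro mult_left_mono) auto
      also have "\<dots> = D * (norm y powr p + norm H1 powr q)" by (simp add: D_def)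
      also have "\<dots> \<le> D * ((\<eta> * norm K powr q + C * norm H powr q) + norm H1 powr q)"
        using yK D by (intro mult_left_mono) auto
      also have "\<dots> = (D * \<eta>) * norm K powr q + D * (C * norm H powr q + norm H1 powr q)"
        by (simp add: algebra_simps)
      also have "\<dots> \<le> 1 / 2 * norm K powr q + D * (C * norm H powr q + norm H1 powr q)"
        using \<eta> by (intro add_right_mono mult_right_mono) auto
      finally have K: "norm K powr q \<le> 2 * D * (C * norm H powr q + norm H1 powr q)" by simp
      have "\<eta> * norm K powr q \<le> 1 * norm K powr q"
        using \<eta> by (intro mult_right_mono) auto
      with yK K have "norm y powr p \<le> 2 * D * (C * norm H powr q + norm H1 powr q) + C * norm H powr q"
        by linarith
      also have "\<dots> \<le> C' * (norm H powr q + norm H1 powr q)"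
        using C D by (simp add: C'_def algebra_simps)
      finally show ?thesis by (simp add: y_def)
    qed
  qed
  have "0 \<le> C'" using C D by (simp add: C'_def)
  then show thesis using bound that by blast
qed

section \<open>Integrals over fibres and absorption of a half\<close>

lemma nn_integral_fibres:
  fixes N :: "'a \<Rightarrow> nat"
  assumes [measurable]: "\<phi> \<in> borel_measurable M" "N \<in> measurable M (count_space UNIV)"
  shows "(\<integral>\<^sup>+x. \<phi> x \<partial>M) = (\<Sum>n. \<integral>\<^sup>+x. \<phi> x * indicator (N -` {n}) x \<partial>M)"
proof -
  have "(\<Sum>n. \<phi> x * indicator (N -` {n}) x) = \<phi> x" for x
    by (rule suminf_cmult_indicator) (auto simp: disjoint_family_on_def)
  then have "(\<integral>\<^sup>+x. \<phi> x \<partial>M) = (\<integral>\<^sup>+x. (\<Sum>n. \<phi> x * indicator (N -` {n}) x) \<partial>M)"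
    by simp
  also have "\<dots> = (\<Sum>n. \<integral>\<^sup>+x. \<phi> x * indicator (N -` {n}) x \<partial>M)"
  proof (rule nn_integral_suminf)
    fix n
    have "(\<lambda>x. \<phi> x * (if N x = n then 1 else 0)) \<in> borel_measurable M" by measurable
    then show "(\<lambda>x. \<phi> x * indicator (N -` {n}) x) \<in> borel_measurable M"
      by (simp add: indicator_def)
  qed
  finally show ?thesis .
qed

text \<open>Half of \<open>e\<close> is cancelled, which its finiteness permits.\<close>

lemma ennreal_le_double:
  fixes e r :: ennreal
  assumes "e < \<infinity>" "e \<le> ennreal (1 / 2) * e + r"
  shows "e \<le> 2 * r"
proof -
  have half: "ennreal (1 / 2) * e + ennreal (1 / 2) * e = e"
    by (simp only: distrib_right [symmetric] ennreal_plus [symmetric]) simp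
  then have "ennreal (1 / 2) * e + ennreal (1 / 2) * e \<le> ennreal (1 / 2) * e + r"
    using assms(2) by simp
  moreover have "ennreal (1 / 2) * e < \<infinity>"
    using assms(1) by (simp add: ennreal_mult_less_top del: ennreal_half)
  ultimately have "ennreal (1 / 2) * e \<le> r"
    by (auto simp: ennreal_add_left_cancel_le)
  then have "ennreal (1 / 2) * e + ennreal (1 / 2) * e \<le> r + r"
    by (intro add_mono)
  then show ?thesis by (simp only: half mult_2)
qed

section \<open>Descent from exponent q to exponent p\<close>

theorem theorem5p4:
  fixes M :: "'a measure"
    and p q :: real
    and \<sigma> :: "'g::topological_group_add \<Rightarrow> 'a \<Rightarrow> 'a"
    and \<omega> :: "'g \<Rightarrow> 'a \<Rightarrow> complex"
  assumes pq: "1 \<le> p" "p < q"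
    and sfin: "sigma_finite_measure M"
    and std: "\<exists>(f :: 'a \<Rightarrow> 'p::polish_space) B. borel_iso_onto M f B"
    and aut: "\<And>g. nonsing_aut M (\<sigma> g)"
    and omega_meas: "\<And>g. \<omega> g \<in> borel_measurable M"
    and omega_T: "\<And>g. AE x in M. norm (\<omega> g x) = 1"
    and hom_sigma: "\<And>g h. AE x in M. \<sigma> (g + h) x = \<sigma> g (\<sigma> h x)"
    and hom_omega: "\<And>g h. AE x in M.
           \<omega> (g + h) x = \<omega> g x * \<omega> h (inv_into (space M) (\<sigma> g) x)"
    and cont_sigma: "aut_continuous M \<sigma>"
    and cont_omega: "L0_continuous M \<omega>"
    and Hq: "H1_sharp_vanishes M q \<sigma> \<omega>"
  shows "H1_sharp_vanishes M p \<sigma> \<omega>"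
  unfolding H1_sharp_vanishes_def
proof (intro ballI impI)
  fix f assume f [measurable]: "f \<in> borel_measurable M"
    and fp: "\<forall>g. memLp M p (\<lambda>x. pi_op M p (\<sigma> g) (\<omega> g) f x - f x)"
  have pos: "0 < p" "0 < q" "p \<le> q" using pq by auto
  note split = mazur_cocycle_split [OF pos(1,3) aut omega_meas omega_T Hq]
  note diff = memLp_coboundary_diff_invariant [OF _ _ aut omega_meas]
  define Inv where "Inv = {v. pi_invariant M p \<sigma> \<omega> v}"

  obtain K H where K: "pi_invariant M q \<sigma> \<omega> K" and H: "memLp M q H"
    and KH: "\<And>x. mazur (p / q) (f x) = K x + H x"
    using split [OF f] fp by blast
  \<comment> \<open>Since \<open>mazur (q / p)\<close> inverts \<open>mazur (p / q)\<close>, this is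
    the invariant candidate for approximating \<open>f\<close>.\<close>
  define k where "k = (\<lambda>x. mazur (q / p) (K x))"
  have k: "pi_invariant M p \<sigma> \<omega> k"
    unfolding k_def by (rule pi_invariant_mazur [OF K pos(2) omega_T])
  define f1 where "f1 = (\<lambda>x. f x - k x)"
  have [measurable]: "k \<in> borel_measurable M" "K \<in> borel_measurable M" "H \<in> borel_measurable M"
    using k K H by (auto simp: pi_invariant_def memLp_def)
  have f1 [measurable]: "f1 \<in> borel_measurable M" by (simp add: f1_def)
  have f1p: "memLp M p (\<lambda>x. pi_op M p (\<sigma> g) (\<omega> g) f1 x - f1 x)" for g
    unfolding f1_def using fp by (intro diff [OF k f]) auto

  obtain K1 H1 where K1: "pi_invariant M q \<sigma> \<omega> K1" and H1: "memLp M q H1"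
    and KH1: "\<And>x. mazur (p / q) (f1 x) = K1 x + H1 x"
    using split [OF f1 f1p] by blast
  have [measurable]: "K1 \<in> borel_measurable M" "H1 \<in> borel_measurable M"
    using K1 H1 by (auto simp: pi_invariant_def memLp_def)

  \<comment> \<open>Division by zero puts the set \<open>K1 = 0\<close> into the piece \<open>N = 0\<close>.\<close>
  define N where "N = (\<lambda>x. nat \<lceil>norm (K x) / norm (K1 x)\<rceil>)"
  have N [measurable]: "N \<in> measurable M (count_space UNIV)"
    unfolding N_def by measurable
  have N_inv: "AE x in M. enn2real (RN_deriv M (distr M M (\<sigma> g)) x) = 0 \<or>
      N (inv_into (space M) (\<sigma> g) x) = N x" for g
    using invariant_ratio [OF K K1 omega_T, of g] by eventually_elim (auto simp: N_def)
  have ind [measurable]: "(\<lambda>x. indicator (N -` {n}) x :: ennreal) \<in> borel_measurable M" for n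
  proof -
    have "(\<lambda>x. if N x = n then 1 else 0 :: ennreal) \<in> borel_measurable M" by measurable
    then show ?thesis by (simp add: indicator_def)
  qed

  \<comment> \<open>The objective to be minimised over invariant \<open>v\<close>: the p-th power of
    an L_p distance on one piece.\<close>
  define E where "E n v = (\<integral>\<^sup>+x. ennreal (norm (f1 x - v x) powr p) * indicator (N -` {n}) x \<partial>M)" for n v
  \<comment> \<open>The constant of the remainder bound depends on \<open>n\<close>, so this gives
    finiteness piece by piece but no summable bound.\<close>
  have E0: "E n (\<lambda>_. 0) < \<infinity>" for n
  proof -
    obtain C where C: "0 \<le> C"
      "\<And>z K H K1 H1. \<lbrakk>mazur (p / q) z = K + H; mazur (p / q) (z - mazur (q / p) K) = K1 + H1;
        K1 = 0 \<or> norm K \<le> real n * norm K1\<rbrakk>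
      \<Longrightarrow> norm (z - mazur (q / p) K) powr p \<le> C * (norm H powr q + norm H1 powr q)"
      using mazur_remainder_bound [OF pos(1,2), of "real n"] by auto
    have "norm (f1 x) powr p \<le> C * (norm (H x) powr q + norm (H1 x) powr q)" if "N x = n" for x
    proof -
      have "norm (K x) / norm (K1 x) \<le> real n"
        using that unfolding N_def by linarith
      then have "K1 x = 0 \<or> norm (K x) \<le> real n * norm (K1 x)"
        by (auto simp: divide_le_eq split: if_splits)
      then show ?thesis
        using C(2) [OF KH [of x], of "K1 x" "H1 x"] KH1 [of x] by (auto simp: f1_def k_def)
    qed
    then have "ennreal (norm (f1 x) powr p) * indicator (N -` {n}) x
        \<le> ennreal C * (ennreal (norm (H x) powr q) + ennreal (norm (H1 x) powr q))" for x
      using C(1) by (auto simp: indicator_def ennreal_mult [symmetric] ennreal_plus [symmetric]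
          simp del: ennreal_plus intro!: ennreal_leI)
    then have "E n (\<lambda>_. 0) \<le> (\<integral>\<^sup>+x. ennreal C * (ennreal (norm (H x) powr q) + ennreal (norm (H1 x) powr q)) \<partial>M)"
      unfolding E_def by (intro nn_integral_mono) simp
    also have "\<dots> < \<infinity>"
      using H H1 by (simp add: nn_integral_cmult nn_integral_add ennreal_mult_less_top memLp_iff_nn_integral)
    finally show ?thesis .
  qed
  have I: "(INF v\<in>Inv. E n v) < \<infinity>" for n
    using E0 [of n] pi_invariant_0 [of M p \<sigma> \<omega>]
    by (auto simp: Inv_def intro!: le_less_trans [OF INF_lower])

  \<comment> \<open>Finiteness of the infimum makes the inequality strict; the slacks are summable
    over the pieces.\<close>
  have "\<exists>v\<in>Inv. E n v < (INF v\<in>Inv. E n v) + ennreal ((1 / 2) ^ n)" for n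
  proof -
    have "y < y + ennreal ((1 / 2) ^ n)" if "y < \<infinity>" for y
      using that ennreal_add_left_cancel_less [of y 0 "ennreal ((1 / 2) ^ n)"] by auto
    from this [OF I [of n]]
    have "(INF v\<in>Inv. E n v) < (INF v\<in>Inv. E n v) + ennreal ((1 / 2) ^ n)" .
    then show ?thesis by (simp only: INF_less_iff)
  qed
  then obtain v where v: "\<And>n. v n \<in> Inv"
    and v_opt: "\<And>n. E n (v n) < (INF v\<in>Inv. E n v) + ennreal ((1 / 2) ^ n)"
    by metis
  have v_inv: "pi_invariant M p \<sigma> \<omega> (v n)" for n using v by (simp add: Inv_def)
  \<comment> \<open>The near-optimal choices are glued along the invariant index \<open>N\<close>
    into one invariant function.\<close>
  define w where "w = (\<lambda>x. v (N x) x)"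
  have w: "pi_invariant M p \<sigma> \<omega> w"
    unfolding w_def using v_inv N N_inv by (rule pi_invariant_glue)
  define h where "h = (\<lambda>x. f1 x - w x)"
  have [measurable]: "w \<in> borel_measurable M" "v n \<in> borel_measurable M" for n
    using w v_inv by (auto simp: pi_invariant_def)
  have h [measurable]: "h \<in> borel_measurable M" by (simp add: h_def)
  have hp: "memLp M p (\<lambda>x. pi_op M p (\<sigma> g) (\<omega> g) h x - h x)" for g
    unfolding h_def using f1p by (intro diff [OF w f1]) auto

  \<comment> \<open>Splitting the glued \<open>h\<close> makes \<open>H2\<close>, and the constant
    \<open>C\<close> below, common to all pieces.\<close>
  obtain K2 H2 where K2: "pi_invariant M q \<sigma> \<omega> K2" and H2: "memLp M q H2"
    and KH2: "\<And>x. mazur (p / q) (h x) = K2 x + H2 x"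
    using split [OF h hp] by blast
  define k2 where "k2 = (\<lambda>x. mazur (q / p) (K2 x))"
  have k2: "pi_invariant M p \<sigma> \<omega> k2"
    unfolding k2_def by (rule pi_invariant_mazur [OF K2 pos(2) omega_T])
  have [measurable]: "K2 \<in> borel_measurable M" "H2 \<in> borel_measurable M"
    using K2 H2 by (auto simp: pi_invariant_def memLp_def)
  obtain C where C: "0 \<le> C" "\<And>a b. norm (mazur (q / p) a - mazur (q / p) b) powr p
      \<le> 1 / 2 * norm a powr q + C * norm (a - b) powr q"
    using mazur_expand [OF pos(1,2), of "1 / 2"] by auto
  \<comment> \<open>The expansion is taken at \<open>mazur (p / q) (h x)\<close>, whose q-th power
    norm is that of \<open>h x\<close> to the power \<open>p\<close>; the increment is
    \<open>H2 x\<close>.\<close>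
  have hk2: "norm (h x - k2 x) powr p \<le> 1 / 2 * norm (h x) powr p + C * norm (H2 x) powr q" for x
  proof -
    have "mazur (q / p) (mazur (p / q) (h x)) = h x"
      using pos by (simp add: mazur_mazur)
    moreover have "mazur (p / q) (h x) - K2 x = H2 x" by (simp add: KH2)
    moreover have "norm (mazur (p / q) (h x)) powr q = norm (h x) powr p"
      using pos by (simp add: powr_powr)
    ultimately show ?thesis
      using C(2) [of "mazur (p / q) (h x)" "K2 x"] by (simp add: k2_def del: norm_mazur)
  qed

  define J where "J n = (\<integral>\<^sup>+x. ennreal (norm (H2 x) powr q) * indicator (N -` {n}) x \<partial>M)" for n
  have E_v: "E n (v n) = (\<integral>\<^sup>+x. ennreal (norm (h x) powr p) * indicator (N -` {n}) x \<partial>M)" for n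
    unfolding E_def by (intro nn_integral_cong) (auto simp: indicator_def h_def w_def)
  have "E n (v n) \<le> 2 * (ennreal C * J n + ennreal ((1 / 2) ^ n))" for n
  proof (rule ennreal_le_double)
    show "E n (v n) < \<infinity>"
      using v_opt [of n] I [of n] by (auto intro: less_trans)
    \<comment> \<open>A competitor for the infimum: on the piece its error is \<open>h - k2\<close>,
      so near-optimality of \<open>v n\<close> bounds the integral of \<open>h\<close> by that of
      \<open>h - k2\<close> plus the slack.\<close>
    have "(\<lambda>x. v n x + k2 x) \<in> Inv"
      using v_inv k2 by (simp add: Inv_def pi_invariant_add)
    then have "(INF v\<in>Inv. E n v) \<le> E n (\<lambda>x. v n x + k2 x)"
      by (rule INF_lower)
    also have "\<dots> = (\<integral>\<^sup>+x. ennreal (norm (h x - k2 x) powr p) * indicator (N -` {n}) x \<partial>M)"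
      unfolding E_def by (intro nn_integral_cong) (auto simp: indicator_def h_def w_def algebra_simps)
    also have "\<dots> \<le> (\<integral>\<^sup>+x. ennreal (1 / 2) * (ennreal (norm (h x) powr p) * indicator (N -` {n}) x) +
        ennreal C * (ennreal (norm (H2 x) powr q) * indicator (N -` {n}) x) \<partial>M)"
    proof (rule nn_integral_mono)
      fix x
      have "ennreal (norm (h x - k2 x) powr p) \<le> ennreal (1 / 2 * norm (h x) powr p + C * norm (H2 x) powr q)"
        by (intro ennreal_leI hk2)
      also have "\<dots> = ennreal (1 / 2) * ennreal (norm (h x) powr p) + ennreal C * ennreal (norm (H2 x) powr q)"
        using C(1) ennreal_mult [of "1 / 2" "norm (h x) powr p"]
        by (simp add: ennreal_mult del: ennreal_half)
      finally show "ennreal (norm (h x - k2 x) powr p) * indicator (N -` {n}) x \<le>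
          ennreal (1 / 2) * (ennreal (norm (h x) powr p) * indicator (N -` {n}) x) +
          ennreal C * (ennreal (norm (H2 x) powr q) * indicator (N -` {n}) x)"
        by (cases "N x = n") (simp_all add: indicator_def)
    qed
    also have "\<dots> = ennreal (1 / 2) * E n (v n) + ennreal C * J n"
      unfolding E_v J_def by (simp add: nn_integral_add nn_integral_cmult del: ennreal_half)
    finally show "E n (v n) \<le> ennreal (1 / 2) * E n (v n) + (ennreal C * J n + ennreal ((1 / 2) ^ n))"
      using v_opt [of n] by (auto simp: add.assoc [symmetric] intro: less_imp_le order_trans add_right_mono)
  qed
  \<comment> \<open>As \<open>C\<close> is independent of \<open>n\<close>, the \<open>J n\<close>
    add up to the full integral of \<open>H2\<close>, and the slacks to 2.\<close>
  then have "(\<Sum>n. E n (v n)) \<le> (\<Sum>n. 2 * (ennreal C * J n + ennreal ((1 / 2) ^ n)))"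
    by (intro suminf_le) auto
  also have "\<dots> = 2 * (ennreal C * (\<Sum>n. J n) + (\<Sum>n. ennreal ((1 / 2) ^ n)))"
    by (simp add: suminf_add [symmetric])
  also have "(\<Sum>n. J n) = (\<integral>\<^sup>+x. ennreal (norm (H2 x) powr q) \<partial>M)"
    unfolding J_def by (rule nn_integral_fibres [symmetric]) auto
  also have "(\<Sum>n. ennreal ((1 / 2) ^ n)) = ennreal 2"
    using geometric_sums [of "1 / 2 :: real"] by (intro suminf_ennreal_eq) auto
  also have "2 * (ennreal C * (\<integral>\<^sup>+x. ennreal (norm (H2 x) powr q) \<partial>M) + ennreal 2) < \<infinity>"
    using H2 by (auto simp: ennreal_mult_less_top memLp_iff_nn_integral)
  also have "(\<Sum>n. E n (v n)) = (\<integral>\<^sup>+x. ennreal (norm (h x) powr p) \<partial>M)"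
    unfolding E_v by (rule nn_integral_fibres [symmetric]) auto
  finally have "memLp M p h" by (simp add: memLp_iff_nn_integral)
  \<comment> \<open>\<open>f\<close> and \<open>h\<close> differ by the invariant function
    \<open>k + w\<close>.\<close>
  moreover have "AE x in M. pi_op M p (\<sigma> g) (\<omega> g) f x - f x = pi_op M p (\<sigma> g) (\<omega> g) h x - h x" for g
    using pi_invariant_AE_diff [OF pi_invariant_add [OF k w], of g f]
    by (simp add: h_def f1_def diff_diff_eq)
  ultimately show "\<exists>h. memLp M p h \<and> (\<forall>g. AE x in M.
      pi_op M p (\<sigma> g) (\<omega> g) f x - f x = pi_op M p (\<sigma> g) (\<omega> g) h x - h x)"
    by blast
qed

end
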